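(* Let $g(x,z)=\exp((x^2+1)\ln z)=z^{x^2+1}$ for $z>0$. Let $W\subset\mathbb{R}^3$ be the graph $\{(x,y,z): y=g(x,z)\}$ of $g$ for $z>0$ and $x$, $z$ small, and let $X$ be the $x$-axis. Then Whitney's condition $(b)$ holds for $(W,X)$ at $(0,0,0)$.
   Context: Let $\pi$ be the orthogonal projection onto the $x$-axis. $(W,X)$ satisfies Whitney's condition $(b)$ at $(0,0,0)$ if, as $w\to(0,0,0)$ with $w\in W$, both $$\sup_{u\in T_{\pi(w)}X,\,|u|=1} d(u,T_wW)\to0\quad\text{and}\quad \sup\Big\{\Big\langle\nu,\tfrac{\pi(w)-w}{|\pi(w)-w|}\Big\rangle:\nu\in(T_wW)^\perp,|\nu|=1\Big\}\to0.$$ *)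

theory Defs
  imports "HOL-Analysis.Analysis"
begin

text \<open>The tangent space at \<open>p\<close> of a submanifold \<open>M\<close>, as the set of velocities at \<open>p\<close>
  of C1 curves lying in \<open>M\<close>; it is a linear subspace, not translated to \<open>p\<close>.\<close>

definition tangent_space :: "'a::real_normed_vector set \<Rightarrow> 'a \<Rightarrow> 'a set" where
  "tangent_space M p =
     {v. \<exists>\<gamma> e. e > 0 \<and> \<gamma> C1_differentiable_on {-e<..<e} \<and> \<gamma> ` {-e<..<e} \<subseteq> M \<and>
              \<gamma> 0 = p \<and> (\<gamma> has_vector_derivative v) (at (0::real))}"

definition x_axis :: "(real^3) set" where
  "x_axis = range (\<lambda>t. vector [t, 0, 0])"

definition proj_x :: "real^3 \<Rightarrow> real^3" where
  "proj_x w = vector [w $ 1, 0, 0]"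

lemma proj_x_orthogonal_projection:
  "proj_x w \<in> x_axis" "w - proj_x w \<in> x_axis\<^sup>\<bottom>"
  by (auto simp: proj_x_def x_axis_def orthogonal_comp_def orthogonal_def inner_vec_def sum_3)

text \<open>The suprema are real-valued. For a C1 surface \<open>W\<close> and \<open>X\<close> the
  x-axis they are taken over nonempty sets and the values are bounded by 1, so they are genuine suprema.\<close>

definition whitney_b :: "(real^3) set \<Rightarrow> (real^3) set \<Rightarrow> real^3 \<Rightarrow> bool" where
  "whitney_b W X p \<longleftrightarrow>
     ((\<lambda>w. SUP u \<in> {u \<in> tangent_space X (proj_x w). norm u = 1}.
             infdist u (tangent_space W w)) \<longlongrightarrow> 0) (at p within W) \<and>
     ((\<lambda>w. SUP \<nu> \<in> {\<nu> \<in> (tangent_space W w)\<^sup>\<bottom>. norm \<nu> = 1}.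
             \<nu> \<bullet> ((proj_x w - w) /\<^sub>R norm (proj_x w - w))) \<longlongrightarrow> 0) (at p within W)"

definition g :: "real \<Rightarrow> real \<Rightarrow> real" where
  "g x z = exp ((x\<^sup>2 + 1) * ln z)"

lemma g_eq_powr: "z > 0 \<Longrightarrow> g x z = z powr (x\<^sup>2 + 1)"
  by (simp add: g_def powr_def)

definition graph_g :: "real \<Rightarrow> (real^3) set" where
  "graph_g \<delta> = {vector [x, g x z, z] | x z. \<bar>x\<bar> < \<delta> \<and> 0 < z \<and> z < \<delta>}"

end

(* At w = (x, g x z, z) the tangent plane of the graph is spanned by (1, g_x, 0) and (0, g_z, 1).
   Since -z ln z <= 1 - z, we get |g_x| = |2 x z^(x^2+1) ln z| <= 2 |x|, which bounds the distance
   from (1,0,0) to the tangent plane. A normal vector n satisfies n_3 = -g_z n_2, and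
   z g_z = (x^2 + 1) g, so n . (pi(w) - w) = -n_2 g - n_3 z = n_2 x^2 g, whose absolute value is
   at most x^2 |pi(w) - w|. *)
theory Submission
  imports Defs
begin

section \<open>Coordinatewise calculus for curves in three-space\<close>

lemma vec3_eqI:
  fixes u v :: "'a^3"
  assumes "u $ 1 = v $ 1" "u $ 2 = v $ 2" "u $ 3 = v $ 3"
  shows "u = v"
  using assms by (simp add: vec_eq_iff forall_3)

text \<open>In this form the rules for sums and scalar multiples yield derivatives and continuity of
  curves given by triples.\<close>

lemma vector_3_eq_sum_axis:
  "(vector [a, b, c] :: real^3) = a *\<^sub>R axis 1 1 + b *\<^sub>R axis 2 1 + c *\<^sub>R axis 3 1"
  by (rule vec3_eqI) (simp_all add: axis_def)

lemma has_vector_derivative_vector_3: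
  assumes "(a has_real_derivative a') F" "(b has_real_derivative b') F"
    "(c has_real_derivative c') F"
  shows "((\<lambda>t. vector [a t, b t, c t] :: real^3) has_vector_derivative vector [a', b', c']) F"
  unfolding vector_3_eq_sum_axis
proof (intro has_vector_derivative_add)
  have scale: "((\<lambda>t. f t *\<^sub>R v) has_vector_derivative f' *\<^sub>R v) F"
    if "(f has_real_derivative f') F" for f f' and v :: "real^3"
    using that bounded_linear.has_vector_derivative[OF bounded_linear_scaleR_left]
    by (simp add: has_real_derivative_iff_has_vector_derivative)
  show "((\<lambda>t. a t *\<^sub>R axis 1 1 :: real^3) has_vector_derivative a' *\<^sub>R axis 1 1) F"
    "((\<lambda>t. b t *\<^sub>R axis 2 1 :: real^3) has_vector_derivative b' *\<^sub>R axis 2 1) F"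
    "((\<lambda>t. c t *\<^sub>R axis 3 1 :: real^3) has_vector_derivative c' *\<^sub>R axis 3 1) F"
    by (intro scale assms)+
qed

lemma continuous_on_vector_3:
  assumes "continuous_on S a" "continuous_on S b" "continuous_on S c"
  shows "continuous_on S (\<lambda>t. vector [a t, b t, c t] :: real^3)"
  unfolding vector_3_eq_sum_axis by (intro continuous_intros assms)

lemma has_real_derivative_nth:
  fixes \<gamma> :: "real \<Rightarrow> real^'n"
  assumes "(\<gamma> has_vector_derivative v) F"
  shows "((\<lambda>t. \<gamma> t $ i) has_real_derivative v $ i) F"
  using bounded_linear.has_vector_derivative[OF bounded_linear_vec_nth assms]
  by (simp add: has_real_derivative_iff_has_vector_derivative)

text \<open>For \<open>z > 0\<close> this is the differential of \<open>g\<close> at (x, z) applied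
  to (a, b), with the exponential factored out. The partial derivatives are
  \<open>dg x z 1 0\<close> and \<open>dg x z 0 1\<close>.\<close>

definition dg :: "real \<Rightarrow> real \<Rightarrow> real \<Rightarrow> real \<Rightarrow> real" where
  "dg x z a b = g x z * (2 * x * ln z * a + (x\<^sup>2 + 1) / z * b)"

lemma has_real_derivative_g:
  assumes "(X has_real_derivative a) (at t)" "(Z has_real_derivative b) (at t)" "Z t > 0"
  shows "((\<lambda>t. g (X t) (Z t)) has_real_derivative dg (X t) (Z t) a b) (at t)"
  unfolding g_def dg_def
  by (rule derivative_eq_intros refl assms)+ (use assms in \<open>auto simp: field_simps power2_eq_square\<close>)

section \<open>Tangent spaces of the axis and of the graph\<close>

lemma tangent_space_x_axis: "tangent_space x_axis (vector [x, 0, 0]) = x_axis"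
proof (intro subset_antisym subsetI)
  fix v assume "v \<in> tangent_space x_axis (vector [x, 0, 0])"
  then obtain \<gamma> e where e: "e > 0" and sub: "\<gamma> ` {-e<..<e} \<subseteq> x_axis"
    and d: "(\<gamma> has_vector_derivative v) (at (0::real))"
    unfolding tangent_space_def by blast
  have "v $ i = 0" if i: "i = 2 \<or> i = 3" for i
  proof -
    \<comment> \<open>Along a curve in the axis this coordinate vanishes on a neighbourhood of 0;
      uniqueness of derivatives then forces \<open>v $ i = 0\<close>.\<close>
    have "((\<lambda>t. \<gamma> t $ i) has_real_derivative 0) (at 0)"
    proof (rule has_field_derivative_transform_within[where f = "\<lambda>_. 0"])
      fix t :: real assume "dist t 0 < e"
      then have "\<gamma> t \<in> x_axis" using sub by (auto simp: dist_real_def abs_less_iff)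
      then show "0 = \<gamma> t $ i" using i by (auto simp: x_axis_def)
    qed (use e in auto)
    then show ?thesis using has_real_derivative_nth[OF d] DERIV_unique by blast
  qed
  then have "v = vector [v $ 1, 0, 0]" by (intro vec3_eqI) auto
  then show "v \<in> x_axis" unfolding x_axis_def by blast
next
  fix v assume "v \<in> x_axis"
  then obtain a where v: "v = vector [a, 0, 0]" by (auto simp: x_axis_def)
  let ?c = "\<lambda>t. vector [x + a * t, 0, 0] :: real^3"
  have d: "(?c has_vector_derivative v) (at t)" for t
    unfolding v by (rule has_vector_derivative_vector_3) (auto intro!: derivative_eq_intros)
  show "v \<in> tangent_space x_axis (vector [x, 0, 0])"
    unfolding tangent_space_def mem_Collect_eq
  proof (intro exI[of _ ?c] exI[of _ 1] conjI)
    show "?c C1_differentiable_on {- 1<..<1}"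
      unfolding C1_differentiable_on_def using d by (intro exI[of _ "\<lambda>_. v"]) auto
  qed (use d in \<open>auto simp: x_axis_def\<close>)
qed

text \<open>A curve in the graph satisfies y = g(x, z), so the chain rule determines the second
  component of its velocity from the other two. Conversely, lifting the line through (x, z) with
  direction (a, b) to the graph realizes every such velocity.\<close>

lemma tangent_space_graph_g:
  assumes x: "\<bar>x\<bar> < \<delta>" and z: "0 < z" "z < \<delta>"
  shows "tangent_space (graph_g \<delta>) (vector [x, g x z, z]) = {vector [a, dg x z a b, b] | a b. True}"
    (is "?L = ?R")
proof (intro subset_antisym subsetI)
  fix v assume "v \<in> ?L"
  then obtain \<gamma> e where e: "e > 0" and sub: "\<gamma> ` {-e<..<e} \<subseteq> graph_g \<delta>"
    and \<gamma>0: "\<gamma> 0 = vector [x, g x z, z]"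
    and d: "(\<gamma> has_vector_derivative v) (at (0::real))"
    unfolding tangent_space_def by blast
  have "((\<lambda>t. g (\<gamma> t $ 1) (\<gamma> t $ 3)) has_real_derivative dg x z (v $ 1) (v $ 3)) (at 0)"
    using has_real_derivative_g[OF has_real_derivative_nth[OF d] has_real_derivative_nth[OF d], of 3 1]
      \<gamma>0 z by simp
  then have "((\<lambda>t. \<gamma> t $ 2) has_real_derivative dg x z (v $ 1) (v $ 3)) (at 0)"
  proof (rule has_field_derivative_transform_within)
    fix t :: real assume "dist t 0 < e"
    then have "\<gamma> t \<in> graph_g \<delta>" using sub by (auto simp: dist_real_def abs_less_iff)
    then show "g (\<gamma> t $ 1) (\<gamma> t $ 3) = \<gamma> t $ 2" by (auto simp: graph_g_def)
  qed (use e in auto)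
  then have "v $ 2 = dg x z (v $ 1) (v $ 3)"
    using has_real_derivative_nth[OF d] DERIV_unique by blast
  then have "v = vector [v $ 1, dg x z (v $ 1) (v $ 3), v $ 3]"
    by (intro vec3_eqI) auto
  then show "v \<in> ?R" by blast
next
  fix v assume "v \<in> ?R"
  then obtain a b where v: "v = vector [a, dg x z a b, b]" by blast
  let ?X = "\<lambda>t. x + a * t" and ?Z = "\<lambda>t. z + b * t"
  \<comment> \<open>The parameter domain is open, so the line stays inside it for a short
    time.\<close>
  have "\<forall>\<^sub>F t in at 0. \<bar>?X t\<bar> < \<delta> \<and> 0 < ?Z t \<and> ?Z t < \<delta>"
  proof (intro eventually_conj)
    have X: "((\<lambda>t. \<bar>?X t\<bar>) \<longlongrightarrow> \<bar>x + a * 0\<bar>) (at 0)" by (intro tendsto_intros)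
    show "\<forall>\<^sub>F t in at 0. \<bar>?X t\<bar> < \<delta>" using x by (intro order_tendstoD(2)[OF X]) simp
    have Z: "(?Z \<longlongrightarrow> z + b * 0) (at 0)" by (intro tendsto_intros)
    show "\<forall>\<^sub>F t in at 0. 0 < ?Z t" using z by (intro order_tendstoD(1)[OF Z]) simp
    show "\<forall>\<^sub>F t in at 0. ?Z t < \<delta>" using z by (intro order_tendstoD(2)[OF Z]) simp
  qed
  then obtain e where e: "e > 0"
    and near: "\<And>t. t \<noteq> 0 \<Longrightarrow> dist t 0 < e \<Longrightarrow> \<bar>?X t\<bar> < \<delta> \<and> 0 < ?Z t \<and> ?Z t < \<delta>"
    unfolding eventually_at by blast
  \<comment> \<open>The filter \<open>at 0\<close> leaves out \<open>t = 0\<close>, where the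
    conditions are the hypotheses on \<open>x\<close> and \<open>z\<close>.\<close>
  have dom: "\<bar>?X t\<bar> < \<delta> \<and> 0 < ?Z t \<and> ?Z t < \<delta>" if "t \<in> {-e<..<e}" for t
    using near[of t] x z that by (cases "t = 0") auto
  let ?c = "\<lambda>t. vector [?X t, g (?X t) (?Z t), ?Z t] :: real^3"
  let ?D = "\<lambda>t. vector [a, dg (?X t) (?Z t) a b, b] :: real^3"
  have d: "(?c has_vector_derivative ?D t) (at t)" if "t \<in> {-e<..<e}" for t
    using dom[OF that]
    by (intro has_vector_derivative_vector_3 has_real_derivative_g)
       (auto intro!: derivative_eq_intros)
  \<comment> \<open>Positivity of \<open>?Z t\<close> keeps both the logarithm and the quotient in
    \<open>dg\<close> continuous.\<close>
  have "continuous_on {-e<..<e} ?D"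
    unfolding dg_def g_def
    by (intro continuous_on_vector_3 continuous_intros) (use dom in force)+
  then have C1: "?c C1_differentiable_on {-e<..<e}"
    unfolding C1_differentiable_on_def by (intro exI[of _ ?D] conjI ballI d)
  show "v \<in> ?L"
    unfolding tangent_space_def mem_Collect_eq
  proof (intro exI[of _ ?c] exI[of _ e] conjI)
    show "?c ` {-e<..<e} \<subseteq> graph_g \<delta>"
      using dom unfolding graph_g_def by blast
    show "(?c has_vector_derivative v) (at 0)"
      using d[of 0] e v by simp
  qed (use e C1 in auto)
qed

section \<open>Uniform estimates at a point of the graph\<close>

lemma g_le:
  assumes "0 < z" "z < 1"
  shows "g x z \<le> z"
proof -
  have "(x\<^sup>2 + 1) * ln z \<le> 1 * ln z"
    using assms by (intro mult_right_mono_neg) auto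
  then have "g x z \<le> exp (1 * ln z)" unfolding g_def by (rule exp_le_cancel_iff[THEN iffD2])
  then show ?thesis using assms by simp
qed

text \<open>The logarithm in the x-derivative is absorbed by the factor \<open>g x z\<close>, which
  is at most \<open>z\<close>, because \<open>z * \<bar>ln z\<bar>\<close> stays below 1 on the unit
  interval.\<close>

lemma abs_dg_horizontal_le:
  assumes z: "0 < z" "z < 1"
  shows "\<bar>dg x z 1 0\<bar> \<le> 2 * \<bar>x\<bar>"
proof -
  have "- ln z \<le> 1 / z - 1"
    using ln_le_minus_one[of "1 / z"] z by (simp add: ln_div)
  then have "z * \<bar>ln z\<bar> \<le> 1" using z by (simp add: field_simps)
  moreover have "g x z * \<bar>ln z\<bar> \<le> z * \<bar>ln z\<bar>"
    using g_le[OF z] by (intro mult_right_mono) auto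
  ultimately have "2 * \<bar>x\<bar> * (g x z * \<bar>ln z\<bar>) \<le> 2 * \<bar>x\<bar> * 1"
    by (intro mult_left_mono) auto
  moreover have "g x z > 0" by (simp add: g_def)
  ultimately show ?thesis by (simp add: dg_def abs_mult mult_ac)
qed

lemma infdist_graph_g_bound:
  assumes "\<bar>x\<bar> < \<delta>" "0 < z" "z < \<delta>" "z < 1"
    and w: "w = vector [x, g x z, z]"
  shows "\<bar>SUP u \<in> {u \<in> tangent_space x_axis (proj_x w). norm u = 1}.
            infdist u (tangent_space (graph_g \<delta>) w)\<bar> \<le> 2 * \<bar>x\<bar>"
proof (rule cSup_abs_le)
  let ?U = "{u \<in> tangent_space x_axis (proj_x w). norm u = 1}"
  let ?T = "tangent_space (graph_g \<delta>) w"
  have U: "?U = {u \<in> x_axis. norm u = 1}"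
    by (simp add: w proj_x_def tangent_space_x_axis)
  \<comment> \<open>Bounding a real supremum by a bound on its members needs a nonempty set.\<close>
  have "vector [1, 0, 0] \<in> ?U"
    unfolding U by (auto simp: x_axis_def norm_vec_def L2_set_def sum_3)
  then show "(\<lambda>u. infdist u ?T) ` ?U \<noteq> {}" by blast
  fix r assume "r \<in> (\<lambda>u. infdist u ?T) ` ?U"
  then obtain a where r: "r = infdist (vector [a, 0, 0]) ?T"
    and "norm (vector [a, 0, 0] :: real^3) = 1"
    unfolding U by (auto simp: x_axis_def)
  then have a: "\<bar>a\<bar> = 1" by (simp add: norm_vec_def L2_set_def sum_3)
  \<comment> \<open>This tangent vector differs from the unit vector (a, 0, 0) only in its second
    coordinate, so that coordinate bounds the distance to the plane.\<close>
  have "vector [a, dg x z a 0, 0] \<in> ?T"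
    unfolding w tangent_space_graph_g[OF assms(1-3)] by blast
  then have "r \<le> dist (vector [a, 0, 0]) (vector [a, dg x z a 0, 0] :: real^3)"
    unfolding r by (rule infdist_le)
  also have "\<dots> = \<bar>dg x z a 0\<bar>"
    by (simp add: dist_vec_def L2_set_def sum_3 dist_real_def)
  also have "\<dots> = \<bar>dg x z 1 0\<bar>"
    using a by (simp add: dg_def abs_mult)
  also have "\<dots> \<le> 2 * \<bar>x\<bar>"
    using assms by (intro abs_dg_horizontal_le)
  finally show "\<bar>r\<bar> \<le> 2 * \<bar>x\<bar>" using infdist_nonneg[of _ ?T] r by simp
qed

text \<open>For fixed x, \<open>g\<close> is the power of z with exponent x^2 + 1, so Euler's
  relation fails to be that of a function of degree 1 only by x^2 g. The secant to the axis is
  therefore almost tangent.\<close>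

lemma normal_graph_g_bound:
  assumes "\<bar>x\<bar> < \<delta>" and z: "0 < z" "z < \<delta>"
    and w: "w = vector [x, g x z, z]"
  shows "\<bar>SUP \<nu> \<in> {\<nu> \<in> (tangent_space (graph_g \<delta>) w)\<^sup>\<bottom>. norm \<nu> = 1}.
            \<nu> \<bullet> ((proj_x w - w) /\<^sub>R norm (proj_x w - w))\<bar> \<le> x\<^sup>2"
proof (rule cSup_abs_le)
  let ?T = "tangent_space (graph_g \<delta>) w"
  let ?N = "{\<nu> \<in> ?T\<^sup>\<bottom>. norm \<nu> = 1}"
  let ?p = "proj_x w - w"
  let ?f = "\<lambda>\<nu>. \<nu> \<bullet> (?p /\<^sub>R norm ?p)"
  have T: "?T = {vector [a, dg x z a b, b] | a b. True}"
    unfolding w by (rule tangent_space_graph_g[OF assms(1-3)])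
  have linear: "dg x z a b = a * dg x z 1 0 + b * dg x z 0 1" for a b
    by (simp add: dg_def algebra_simps)
  \<comment> \<open>The gradient of y - g(x, z); normalized, it shows that the set of unit normals
    is nonempty.\<close>
  define \<nu> :: "real^3" where "\<nu> = vector [- dg x z 1 0, 1, - dg x z 0 1]"
  have "\<nu> \<noteq> 0" by (auto simp: \<nu>_def vec_eq_iff forall_3)
  moreover have "orthogonal v \<nu>" if "v \<in> ?T" for v
  proof -
    obtain a b where "v = vector [a, dg x z a b, b]" using \<open>v \<in> ?T\<close> T by auto
    then show ?thesis using linear[of a b]
      by (simp add: orthogonal_def inner_vec_def sum_3 \<nu>_def algebra_simps)
  qed
  ultimately have "\<nu> /\<^sub>R norm \<nu> \<in> ?N"
    by (auto simp: orthogonal_comp_def orthogonal_clauses)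
  then show "?f ` ?N \<noteq> {}" by blast
  fix r assume "r \<in> ?f ` ?N"
  then obtain n where n: "\<And>v. v \<in> ?T \<Longrightarrow> orthogonal v n" "norm n = 1" and r: "r = ?f n"
    by (auto simp: orthogonal_comp_def)
  \<comment> \<open>The tangent vector of the slice with x fixed links the two components of
    \<open>n\<close> that meet \<open>?p\<close>, whose first coordinate is 0.\<close>
  have "orthogonal (vector [0, dg x z 0 1, 1]) n"
    using T by (intro n) blast
  then have n3: "n $ 3 = - dg x z 0 1 * n $ 2"
    by (simp add: orthogonal_def inner_vec_def sum_3)
  have p: "?p = vector [0, - g x z, - z]"
    by (rule vec3_eqI) (simp_all add: w proj_x_def)
  have "n \<bullet> ?p = n $ 2 * (z * dg x z 0 1 - g x z)"
    by (simp add: p inner_vec_def sum_3 n3 algebra_simps)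
  also have "z * dg x z 0 1 - g x z = x\<^sup>2 * g x z"
    using z by (simp add: dg_def field_simps)
  finally have "\<bar>n \<bullet> ?p\<bar> = \<bar>n $ 2\<bar> * (x\<^sup>2 * \<bar>g x z\<bar>)" by (simp add: abs_mult)
  \<comment> \<open>Both \<open>n $ 2\<close> and \<open>g x z\<close> are, up to sign, coordinates
    of vectors, hence bounded by the norms of \<open>n\<close> and \<open>?p\<close>.\<close>
  also have "\<dots> \<le> 1 * (x\<^sup>2 * norm ?p)"
    using component_le_norm_cart[of n 2] component_le_norm_cart[of ?p 2] n(2)
    by (intro mult_mono) (auto simp: p)
  finally have "\<bar>n \<bullet> ?p\<bar> \<le> x\<^sup>2 * norm ?p" by simp
  moreover have "z \<le> norm ?p"
    using z component_le_norm_cart[of ?p 3] by (simp add: p)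
  with z have "0 < norm ?p" by linarith
  ultimately have "\<bar>n \<bullet> ?p\<bar> / norm ?p \<le> x\<^sup>2" by (simp only: pos_divide_le_eq)
  then show "\<bar>r\<bar> \<le> x\<^sup>2"
    by (simp only: r inner_scaleR_right abs_mult abs_inverse abs_norm_cancel divide_inverse mult.commute)
qed

section \<open>Passage to the limit at the origin\<close>

theorem mainTheorem11:
  fixes \<delta> :: real
  assumes "\<delta> > 0"
  shows "whitney_b (graph_g \<delta>) x_axis 0"
proof -
  let ?W = "graph_g \<delta>"
  \<comment> \<open>Since \<open>\<delta>\<close> may be large, smallness comes from the limit:
    \<open>norm w < 1\<close> gives \<open>z < 1\<close> for the logarithm bound and
    \<open>\<bar>x\<bar> < 1\<close> for the comparison of x^2 with
    \<open>\<bar>x\<bar>\<close>.\<close>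
  have "\<forall>\<^sub>F w in at 0 within ?W. w \<in> ?W \<and> norm w < 1"
    unfolding eventually_at by (intro exI[of _ 1]) auto
  then have near: "\<forall>\<^sub>F w in at 0 within ?W. \<exists>x z. w = vector [x, g x z, z] \<and>
      \<bar>x\<bar> < \<delta> \<and> 0 < z \<and> z < \<delta> \<and> z < 1 \<and> \<bar>x\<bar> < 1 \<and> \<bar>x\<bar> \<le> norm w"
  proof eventually_elim
    case (elim w)
    then obtain x z where "w = vector [x, g x z, z]" "\<bar>x\<bar> < \<delta>" "0 < z" "z < \<delta>"
      by (auto simp: graph_g_def)
    then show ?case
      using component_le_norm_cart[of w 1] component_le_norm_cart[of w 3] elim
      by (intro exI[of _ x] exI[of _ z]) auto
  qed
  \<comment> \<open>One linear majorant serves both conditions, as 2 \<open>\<bar>x\<bar>\<close>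
    and x^2 are each at most twice the norm of \<open>w\<close> near 0.\<close>
  have lim: "((\<lambda>w. 2 * norm w) \<longlongrightarrow> 0) (at (0::real^3) within ?W)"
    by (auto intro!: tendsto_eq_intros)
  show ?thesis
    unfolding whitney_b_def
  proof (intro conjI; rule Lim_null_comparison[OF _ lim])
    show "\<forall>\<^sub>F w in at 0 within ?W.
        norm (SUP u \<in> {u \<in> tangent_space x_axis (proj_x w). norm u = 1}.
          infdist u (tangent_space ?W w)) \<le> 2 * norm w"
      using near
    proof eventually_elim
      case (elim w)
      then obtain x z where *: "w = vector [x, g x z, z]" "\<bar>x\<bar> < \<delta>" "0 < z" "z < \<delta>" "z < 1"
        "\<bar>x\<bar> \<le> norm w" by blast
      show ?case using infdist_graph_g_bound[OF *(2-5) *(1)] *(6) by simp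
    qed
    show "\<forall>\<^sub>F w in at 0 within ?W.
        norm (SUP \<nu> \<in> {\<nu> \<in> (tangent_space ?W w)\<^sup>\<bottom>. norm \<nu> = 1}.
          \<nu> \<bullet> ((proj_x w - w) /\<^sub>R norm (proj_x w - w))) \<le> 2 * norm w"
      using near
    proof eventually_elim
      case (elim w)
      then obtain x z where *: "w = vector [x, g x z, z]" "\<bar>x\<bar> < \<delta>" "0 < z" "z < \<delta>"
        "\<bar>x\<bar> < 1" "\<bar>x\<bar> \<le> norm w" by blast
      have "x\<^sup>2 \<le> \<bar>x\<bar>"
        using *(5) mult_left_le[of "\<bar>x\<bar>" "\<bar>x\<bar>"] by (simp add: power2_eq_square abs_mult[symmetric])
      then show ?case using normal_graph_g_bound[OF *(2-4) *(1)] *(6) by simp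
    qed
  qed
qed

end
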